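(* Let $\alpha\in\mathbb R\setminus\{0\}$ and let $f\in\mathcal C^\infty_0(\mathbb R_+,\mathbb C)$ have support contained in $[0,\frac\pi{|\alpha|})$. For $k\in\mathbb N^*$ set $$S_k^-(f)=\tfrac12f(0)+\sum_{\ell=1}^\infty(-1)^\ell e^{i\frac\alpha2\ell^2/k}f\Bigl(\frac\ell k\Bigr).$$ If $f$ is even, then $S_k^-(f)=O(k^{-\infty})$ as $k\to\infty$. If $f$ is odd and $f(x)=O(x^n)$ at the origin, then $$S_k^-(f)=k^{-n}\sum_{\ell=0}^\infty k^{-\ell}c_\ell+O(k^{-\infty})$$ for some complex coefficients $c_\ell$.
   Context: $\mathbb R_+=[0,\infty)$, and $\mathcal C_0^\infty(\mathbb R_+,\mathbb C)$ is the space of smooth (up to $0$) compactly supported functions on $\mathbb R_+$. A function in $\mathcal C^\infty(\mathbb R_+)$ is called even (resp. odd) if its Taylor expansion at the origin contains only even (resp. odd) monomials. Here $n\in\mathbb N$. Infinite series with $O(k^{-\infty})$ are asymptotic expansions. *)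

theory Defs
  imports "HOL-Analysis.Analysis" "HOL-Library.Landau_Symbols"
begin

text \<open>
  Functions on the closed half-line are represented by total functions on the reals; their values
  at negative arguments play no role below. At the origin all derivatives are one-sided.
\<close>

definition half_line_deriv :: "nat \<Rightarrow> (real \<Rightarrow> complex) \<Rightarrow> real \<Rightarrow> complex" where
  "half_line_deriv j f = ((\<lambda>g x. vector_derivative g (at x within {0..})) ^^ j) f"

definition half_line_smooth :: "(real \<Rightarrow> complex) \<Rightarrow> bool" where
  "half_line_smooth f \<longleftrightarrow> (\<forall>j. half_line_deriv j f differentiable_on {0..})"

definition half_line_support :: "(real \<Rightarrow> complex) \<Rightarrow> real set" where
  "half_line_support f = closure {x. 0 \<le> x \<and> f x \<noteq> 0}"

definition half_line_test_function :: "(real \<Rightarrow> complex) \<Rightarrow> bool" where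
  "half_line_test_function f \<longleftrightarrow> half_line_smooth f \<and> compact (half_line_support f)"

definition taylor_coeff :: "(real \<Rightarrow> complex) \<Rightarrow> nat \<Rightarrow> complex" where
  "taylor_coeff f j = half_line_deriv j f 0 / fact j"

definition even_at_origin :: "(real \<Rightarrow> complex) \<Rightarrow> bool" where
  "even_at_origin f \<longleftrightarrow> (\<forall>j. taylor_coeff f j \<noteq> 0 \<longrightarrow> even j)"

definition odd_at_origin :: "(real \<Rightarrow> complex) \<Rightarrow> bool" where
  "odd_at_origin f \<longleftrightarrow> (\<forall>j. taylor_coeff f j \<noteq> 0 \<longrightarrow> odd j)"

text \<open>
  The summation index is shifted so that the series starts at 1. For boundedly supported \<open>f\<close> and
  \<open>k > 0\<close> only finitely many terms are nonzero. The value at \<open>k = 0\<close> is junk; only the limit of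
  large \<open>k\<close> is considered.
\<close>

definition S_minus :: "real \<Rightarrow> (real \<Rightarrow> complex) \<Rightarrow> nat \<Rightarrow> complex" where
  "S_minus \<alpha> f k = f 0 / 2 +
     (\<Sum>m. let l = Suc m in
        (-1) ^ l * exp (\<i> * of_real (\<alpha> / 2 * (real l)\<^sup>2 / real k)) * f (real l / real k))"

definition rapidly_decaying :: "(nat \<Rightarrow> complex) \<Rightarrow> bool" where
  "rapidly_decaying s \<longleftrightarrow> (\<forall>N. s \<in> O(\<lambda>k. 1 / of_nat k ^ N))"

text \<open>
  The expansion \<open>s k = k\<^sup>-\<^sup>n (\<Sum>l. c l k\<^sup>-\<^sup>l) + O(k\<^sup>-\<^sup>\<infinity>)\<close> is in the sense of
  Poincare: the series need not converge, and every truncation has an error of the order of the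
  first omitted term.
\<close>

definition has_asymptotic_expansion :: "(nat \<Rightarrow> complex) \<Rightarrow> nat \<Rightarrow> (nat \<Rightarrow> complex) \<Rightarrow> bool" where
  "has_asymptotic_expansion s n c \<longleftrightarrow>
     (\<forall>N. (\<lambda>k. s k - 1 / of_nat k ^ n * (\<Sum>l<N. 1 / of_nat k ^ l * c l))
            \<in> O(\<lambda>k. 1 / of_nat k ^ (n + N)))"

end

theory Submission
  imports Defs
begin

text \<open>
  On the support of \<open>f\<close> the phase increments of \<open>(-1)\<^sup>l e\<^bsup>i\<alpha>l\<^sup>2/2k\<^esup>\<close> stay away from \<open>2\<pi>\<int>\<close>, because
  \<open>\<bar>\<alpha>l/k\<bar> < \<pi>\<close>. Hence the summand is, to leading order, the difference of an explicit sequence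
  whose amplitude is \<open>- f x / (2 cos (\<alpha>x/2))\<close>. The sum telescopes to a boundary term plus sums of the
  same type with amplitudes multiplied by positive powers of \<open>1/k\<close>, which come from a Taylor
  expansion. Iterating gives an expansion whose \<open>m\<close>-th coefficient depends only on the derivatives of \<open>f\<close>
  of order at most \<open>m\<close> at the left endpoint. Starting at \<open>0\<close>, the coefficients of order less than \<open>n\<close> vanish
  if \<open>f x = O(x\<^sup>n)\<close>. If \<open>f\<close> is even, then \<open>2 S\<^sub>k\<close> is the sum of the smooth even extension over all
  integers, which starts where the extension vanishes identically, so that all coefficients are zero.
\<close>

section \<open>Smooth functions on a compact interval\<close>

definition deriv_on :: "real set \<Rightarrow> (real \<Rightarrow> complex) \<Rightarrow> real \<Rightarrow> complex" where
  "deriv_on T f x = vector_derivative f (at x within T)"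

text \<open>Finite orders allow induction on the order with the function generalised; smoothness
  itself offers no such induction, so closure properties are proved at this level first.\<close>

fun diff_times :: "real set \<Rightarrow> nat \<Rightarrow> (real \<Rightarrow> complex) \<Rightarrow> bool" where
  "diff_times T 0 f = True"
| "diff_times T (Suc k) f = (f differentiable_on T \<and> diff_times T k (deriv_on T f))"

definition smooth_within :: "real set \<Rightarrow> (real \<Rightarrow> complex) \<Rightarrow> bool" where
  "smooth_within T f \<longleftrightarrow> (\<forall>k. diff_times T k f)"

lemma has_vector_derivative_transform_iff:
  assumes "x \<in> T" "\<And>x. x \<in> T \<Longrightarrow> f x = g x"
  shows "(f has_vector_derivative d) (at x within T) \<longleftrightarrow> (g has_vector_derivative d) (at x within T)"
  using assms by (metis has_vector_derivative_transform)

text \<open>Valid for nondifferentiable functions as well: \<open>vector_derivative\<close> is a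
  choice from the set of derivatives, and both functions have the same set.\<close>

lemma deriv_on_cong:
  assumes "x \<in> T" "\<And>x. x \<in> T \<Longrightarrow> f x = g x"
  shows "deriv_on T f x = deriv_on T g x"
  using has_vector_derivative_transform_iff[OF assms]
  by (simp add: deriv_on_def vector_derivative_def)

lemma deriv_on_works:
  assumes "f differentiable_on T" "x \<in> T"
  shows "(f has_vector_derivative deriv_on T f x) (at x within T)"
  using assms by (simp add: deriv_on_def differentiable_on_def vector_derivative_works)

lemma differentiable_on_iff:
  fixes f :: "real \<Rightarrow> complex"
  shows "f differentiable_on T \<longleftrightarrow> (\<forall>x\<in>T. \<exists>d. (f has_vector_derivative d) (at x within T))"
  unfolding differentiable_on_def using vector_derivative_works differentiableI_vector by blast

lemma diff_times_cong:
  assumes "\<And>x. x \<in> T \<Longrightarrow> f x = g x"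
  shows "diff_times T k f \<longleftrightarrow> diff_times T k g"
  using assms
proof (induction k arbitrary: f g)
  case (Suc k)
  have "f differentiable_on T \<longleftrightarrow> g differentiable_on T"
    using has_vector_derivative_transform_iff[OF _ Suc.prems] by (simp add: differentiable_on_iff)
  moreover have "diff_times T k (deriv_on T f) \<longleftrightarrow> diff_times T k (deriv_on T g)"
    by (rule Suc.IH) (rule deriv_on_cong[OF _ Suc.prems])
  ultimately show ?case by simp
qed simp

lemma smooth_within_cong:
  assumes "\<And>x. x \<in> T \<Longrightarrow> f x = g x"
  shows "smooth_within T f \<longleftrightarrow> smooth_within T g"
  using diff_times_cong[OF assms] by (simp add: smooth_within_def)

lemma diff_times_Suc_imp: "diff_times T (Suc k) f \<Longrightarrow> diff_times T k f"
  by (induction k arbitrary: f) auto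

lemma smooth_within_step:
  "smooth_within T f \<longleftrightarrow> f differentiable_on T \<and> smooth_within T (deriv_on T f)"
proof
  assume *: "smooth_within T f"
  then have "diff_times T (Suc k) f" for k by (simp only: smooth_within_def)
  then show "f differentiable_on T \<and> smooth_within T (deriv_on T f)"
    by (auto simp: smooth_within_def)
next
  assume "f differentiable_on T \<and> smooth_within T (deriv_on T f)"
  then have "diff_times T (Suc k) f" for k by (simp add: smooth_within_def)
  then show "smooth_within T f"
    unfolding smooth_within_def using diff_times_Suc_imp by blast
qed

lemma smooth_within_imp:
  assumes "smooth_within T f"
  shows "f differentiable_on T" "smooth_within T (deriv_on T f)"
  using assms smooth_within_step by blast+

lemma smooth_within_deriv_on:
  assumes "smooth_within T f"
  shows "smooth_within T ((deriv_on T ^^ j) f)"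
proof (induction j)
  case (Suc j)
  then show ?case using smooth_within_imp(2) by simp
qed (simp add: assms)

lemma smooth_within_has_vector_derivative:
  assumes "smooth_within T f" "x \<in> T"
  shows "((deriv_on T ^^ j) f has_vector_derivative (deriv_on T ^^ Suc j) f x) (at x within T)"
  using deriv_on_works[OF smooth_within_imp(1)[OF smooth_within_deriv_on[OF assms(1)]] assms(2)]
  by simp

text \<open>Nondegeneracy makes derivatives within the interval unique, also at its two
  endpoints.\<close>

locale compact_interval =
  fixes a c :: real
  assumes ac: "a < c"
begin

abbreviation I :: "real set" where "I \<equiv> {a..c}"
abbreviation D :: "(real \<Rightarrow> complex) \<Rightarrow> real \<Rightarrow> complex" where "D \<equiv> deriv_on I"

lemma D_eqI:
  assumes "x \<in> I" "(f has_vector_derivative d) (at x within I)"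
  shows "D f x = d"
  unfolding deriv_on_def by (rule vector_derivative_within_closed_interval[OF ac assms])

lemma diff_times_SucI:
  assumes d: "\<And>x. x \<in> I \<Longrightarrow> (f has_vector_derivative d x) (at x within I)"
    and k: "diff_times I k d"
  shows "diff_times I (Suc k) f"
proof -
  have "\<exists>e. (f has_vector_derivative e) (at x within I)" if "x \<in> I" for x
    by (rule exI[of _ "d x"]) (rule d[OF that])
  then have "f differentiable_on I" unfolding differentiable_on_iff by (rule ballI)
  moreover have "D f x = d x" if "x \<in> I" for x
    by (rule D_eqI[OF that d[OF that]])
  then have "diff_times I k (D f) = diff_times I k d"
    by (rule diff_times_cong)
  ultimately show ?thesis using k by simp
qed

text \<open>Uniqueness of derivatives identifies \<open>F\<close> with the chain of iterated
  derivatives. This serves for restrictions to an interval and for the even extension, where the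
  whole chain is known explicitly.\<close>

lemma jet:
  assumes "\<And>j x. x \<in> I \<Longrightarrow> (F j has_vector_derivative F (Suc j) x) (at x within I)"
  shows "smooth_within I (F j)" and "\<And>x. x \<in> I \<Longrightarrow> (D ^^ j) (F 0) x = F j x"
proof -
  have "diff_times I k (F j)" for k
  proof (induction k arbitrary: j)
    case (Suc k)
    show ?case by (rule diff_times_SucI[OF assms Suc])
  qed simp
  then show "smooth_within I (F j)" by (simp add: smooth_within_def)
  show "(D ^^ j) (F 0) x = F j x" if "x \<in> I" for x
    using that
  proof (induction j arbitrary: x)
    case (Suc j)
    have "(D ^^ Suc j) (F 0) x = D (F j) x"
      using deriv_on_cong[OF Suc.prems Suc.IH] by simp
    also have "\<dots> = F (Suc j) x" by (rule D_eqI[OF Suc.prems assms[OF Suc.prems]])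
    finally show ?case .
  qed simp
qed

section \<open>Closure of smooth functions under algebraic operations\<close>

lemma diff_times_add:
  "diff_times I k f \<Longrightarrow> diff_times I k g \<Longrightarrow> diff_times I k (\<lambda>x. f x + g x)"
proof (induction k arbitrary: f g)
  case (Suc k)
  show ?case
    using Suc.prems
    by (intro diff_times_SucI[where d = "\<lambda>x. D f x + D g x"] has_vector_derivative_add
        deriv_on_works Suc.IH) auto
qed simp

lemma diff_times_mult:
  "diff_times I k f \<Longrightarrow> diff_times I k g \<Longrightarrow> diff_times I k (\<lambda>x. f x * g x)"
proof (induction k arbitrary: f g)
  case (Suc k)
  show ?case
    using Suc.prems
    by (intro diff_times_SucI[where d = "\<lambda>x. f x * D g x + D f x * g x"] has_vector_derivative_mult
        deriv_on_works diff_times_add Suc.IH) (auto intro: diff_times_Suc_imp)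
qed simp

lemma diff_times_const: "diff_times I k (\<lambda>x. C)"
proof (induction k arbitrary: C)
  case (Suc k)
  show ?case by (rule diff_times_SucI[where d = "\<lambda>_. 0"]) (auto intro: Suc)
qed simp

lemma diff_times_inverse:
  "diff_times I k f \<Longrightarrow> (\<And>x. x \<in> I \<Longrightarrow> f x \<noteq> 0) \<Longrightarrow> diff_times I k (\<lambda>x. inverse (f x))"
proof (induction k arbitrary: f)
  case (Suc k)
  \<comment> \<open>The derivative of the reciprocal again contains the reciprocal, which is covered
    to order \<open>k\<close> by the induction hypothesis.\<close>
  have inv: "diff_times I k (\<lambda>x. inverse (f x))"
    by (rule Suc.IH[OF diff_times_Suc_imp[OF Suc.prems(1)] Suc.prems(2)])
  show ?case
  proof (rule diff_times_SucI)
    show "((\<lambda>x. inverse (f x)) has_vector_derivative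
        (D f x * -1) * (inverse (f x) * inverse (f x))) (at x within I)" if "x \<in> I" for x
    proof -
      have "((inverse \<circ> f) has_vector_derivative D f x * - (inverse (f x) * inverse (f x)))
          (at x within I)"
        using Suc.prems that
        by (intro field_vector_diff_chain_within deriv_on_works)
          (auto intro!: derivative_eq_intros simp: power2_eq_square)
      then show ?thesis by (simp add: o_def mult_ac)
    qed
  qed (intro diff_times_mult inv diff_times_const, use Suc.prems in auto)
qed simp

text \<open>The factor \<open>C\<close> makes the family closed under differentiation, which only
  changes the constant.\<close>

lemma diff_times_exp: "diff_times I k (\<lambda>x. C * cis (\<beta> * x))"
proof (induction k arbitrary: C)
  case (Suc k)
  show ?case
  proof (rule diff_times_SucI)
    show "((\<lambda>x. C * cis (\<beta> * x)) has_vector_derivative (C * (\<i> * of_real \<beta>)) * cis (\<beta> * x))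
        (at x within I)" for x
      by (auto simp: has_vector_derivative_def scaleR_conv_of_real mult_ac
        intro!: derivative_eq_intros)
  qed (rule Suc)
qed simp

lemma smooth_mult:
  "smooth_within I f \<Longrightarrow> smooth_within I g \<Longrightarrow> smooth_within I (\<lambda>x. f x * g x)"
  by (simp add: smooth_within_def diff_times_mult)

lemma smooth_add:
  "smooth_within I f \<Longrightarrow> smooth_within I g \<Longrightarrow> smooth_within I (\<lambda>x. f x + g x)"
  by (simp add: smooth_within_def diff_times_add)

lemma smooth_inverse:
  "smooth_within I f \<Longrightarrow> (\<And>x. x \<in> I \<Longrightarrow> f x \<noteq> 0) \<Longrightarrow> smooth_within I (\<lambda>x. inverse (f x))"
  unfolding smooth_within_def by (blast intro: diff_times_inverse)

lemma smooth_const: "smooth_within I (\<lambda>x. C)"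
  by (simp add: smooth_within_def diff_times_const)

lemma smooth_exp: "smooth_within I (\<lambda>x. C * cis (\<beta> * x))"
  by (simp add: smooth_within_def diff_times_exp)

section \<open>Taylor remainders and intervals of vanishing\<close>

lemma smooth_bounded:
  assumes "smooth_within I f"
  obtains K where "K \<ge> 0" "\<And>x. x \<in> I \<Longrightarrow> norm (f x) \<le> K"
proof -
  have "continuous_on I f"
    using smooth_within_imp(1)[OF assms] by (rule differentiable_imp_continuous_on)
  then have "bounded (f ` I)"
    by (intro compact_imp_bounded compact_continuous_image compact_Icc)
  then obtain K where "K > 0" "\<And>x. x \<in> I \<Longrightarrow> norm (f x) \<le> K"
    unfolding bounded_pos by blast
  then show ?thesis using that[of K] by simp
qed

text \<open>Integral form of the remainder. The bound of the \<open>N\<close>-th derivative over all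
  of \<open>I\<close> makes \<open>K\<close> independent of the base point, as needed when
  remainders at many points are summed.\<close>

lemma taylor_remainder:
  assumes f: "smooth_within I f" and "N > 0"
  obtains K where "K \<ge> 0"
    "\<And>x y. a \<le> x \<Longrightarrow> x \<le> y \<Longrightarrow> y \<le> c \<Longrightarrow>
      norm (f y - (\<Sum>q<N. of_real ((y - x) ^ q / fact q) * (D ^^ q) f x)) \<le> K * (y - x) ^ N"
proof -
  obtain K where K: "K \<ge> 0" "\<And>x. x \<in> I \<Longrightarrow> norm ((D ^^ N) f x) \<le> K"
    using smooth_bounded[OF smooth_within_deriv_on[OF f]] by blast
  show ?thesis
  proof (rule that[OF K(1)])
    fix x y assume xy: "a \<le> x" "x \<le> y" "y \<le> c"
    define R where "R = f y - (\<Sum>q<N. of_real ((y - x) ^ q / fact q) * (D ^^ q) f x)"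
    have der: "((D ^^ m) f has_vector_derivative (D ^^ Suc m) f t) (at t within {x..y})"
      if "x \<le> t" "t \<le> y" for m t
      by (rule has_vector_derivative_within_subset[OF smooth_within_has_vector_derivative[OF f]])
        (use xy that in auto)
    have int: "((\<lambda>t. ((y - t) ^ (N - 1) / fact (N - 1)) *\<^sub>R (D ^^ N) f t) has_integral R) {x..y}"
      using Taylor_has_integral[where Df = "\<lambda>i. (D ^^ i) f", OF \<open>N > 0\<close> _ der xy(2), of f]
      by (simp add: R_def scaleR_conv_of_real)
    have "norm R \<le> (K * (y - x) ^ (N - 1)) * measure lborel (cbox x y)"
    proof (rule has_integral_bound)
      show "norm (((y - t) ^ (N - 1) / fact (N - 1)) *\<^sub>R (D ^^ N) f t) \<le> K * (y - x) ^ (N - 1)"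
        if t: "t \<in> cbox x y" for t
      proof -
        have "(y - t) ^ (N - 1) / fact (N - 1) \<le> (y - x) ^ (N - 1) / 1"
          using t by (intro frac_le power_mono) auto
        moreover have "norm ((D ^^ N) f t) \<le> K" using t xy K by auto
        ultimately have "((y - t) ^ (N - 1) / fact (N - 1)) * norm ((D ^^ N) f t)
            \<le> (y - x) ^ (N - 1) * K"
          using xy by (intro mult_mono) auto
        then show ?thesis using t by (simp add: mult.commute)
      qed
    qed (use int K xy in auto)
    \<comment> \<open>The length of the interval supplies the missing factor
      \<open>y - x\<close>.\<close>
    also have "\<dots> = K * (y - x) ^ N"
      using xy \<open>N > 0\<close> by (cases N) (auto simp: mult_ac)
    finally show "norm (f y - (\<Sum>q<N. of_real ((y - x) ^ q / fact q) * (D ^^ q) f x))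
        \<le> K * (y - x) ^ N" unfolding R_def .
  qed
qed

text \<open>A derivative within \<open>I\<close> is also one within \<open>{u..v}\<close>, where it
  is unique. Hence the claim includes the endpoints \<open>u\<close> and \<open>v\<close>.\<close>

lemma derivs_zero_subinterval:
  assumes f: "smooth_within I f" and uv: "a \<le> u" "u < v" "v \<le> c"
    and zero: "\<And>x. x \<in> {u..v} \<Longrightarrow> f x = 0"
  shows "x \<in> {u..v} \<Longrightarrow> (D ^^ j) f x = 0"
proof (induction j arbitrary: x)
  case (Suc j)
  have "((D ^^ j) f has_vector_derivative (D ^^ Suc j) f x) (at x within {u..v})"
    by (rule has_vector_derivative_within_subset[OF smooth_within_has_vector_derivative[OF f]])
      (use uv Suc in auto)
  moreover have "((D ^^ j) f has_vector_derivative 0) (at x within {u..v})"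
    by (rule has_vector_derivative_transform[OF Suc.prems Suc.IH]) auto
  ultimately show ?case
    using uv Suc.prems vector_derivative_unique_within_closed_interval[of u v x]
    unfolding interval_cbox by blast
qed (use zero in auto)

section \<open>Vanishing to finite order at a point\<close>

definition flat :: "nat \<Rightarrow> (real \<Rightarrow> complex) \<Rightarrow> real \<Rightarrow> bool" where
  "flat n f x \<longleftrightarrow> (\<forall>j<n. (D ^^ j) f x = 0)"

text \<open>Peeling off the innermost derivative gives the recursion on which the inductions below
  rest.\<close>

lemma flat_Suc: "flat (Suc n) f x \<longleftrightarrow> f x = 0 \<and> flat n (D f) x"
proof -
  have "(D ^^ Suc j) f x = (D ^^ j) (D f) x" for j
    by (simp only: funpow_Suc_right o_apply)
  then show ?thesis unfolding flat_def All_less_Suc2 by simp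
qed

lemma flat_mono: "flat n f x \<Longrightarrow> m \<le> n \<Longrightarrow> flat m f x"
  by (auto simp: flat_def)

lemma flat_funpow: "flat n f x \<Longrightarrow> flat (n - q) ((D ^^ q) f) x"
  unfolding flat_def
proof (intro allI impI)
  fix j assume *: "\<forall>j<n. (D ^^ j) f x = 0" "j < n - q"
  have "(D ^^ j) ((D ^^ q) f) x = (D ^^ (j + q)) f x" by (simp only: funpow_add o_apply)
  also have "\<dots> = 0" using * by simp
  finally show "(D ^^ j) ((D ^^ q) f) x = 0" .
qed

lemma funpow_D_cong:
  assumes "\<And>x. x \<in> I \<Longrightarrow> f x = g x"
  shows "x \<in> I \<Longrightarrow> (D ^^ j) f x = (D ^^ j) g x"
proof (induction j arbitrary: x)
  case (Suc j)
  show ?case unfolding funpow.simps o_apply by (rule deriv_on_cong[OF Suc.prems Suc.IH])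
qed (use assms in auto)

lemma flat_cong:
  assumes "x \<in> I" "\<And>x. x \<in> I \<Longrightarrow> f x = g x"
  shows "flat n f x \<longleftrightarrow> flat n g x"
  using funpow_D_cong[OF assms(2) assms(1)] by (simp add: flat_def)

lemma flat_add:
  "smooth_within I f \<Longrightarrow> smooth_within I g \<Longrightarrow> x \<in> I \<Longrightarrow> flat n f x \<Longrightarrow> flat n g x \<Longrightarrow>
    flat n (\<lambda>x. f x + g x) x"
proof (induction n arbitrary: f g)
  case (Suc n)
  have eq: "D (\<lambda>x. f x + g x) y = D f y + D g y" if "y \<in> I" for y
    by (rule D_eqI[OF that])
      (intro has_vector_derivative_add deriv_on_works smooth_within_imp(1) Suc.prems that)
  have "flat n (\<lambda>x. D f x + D g x) x"
    using Suc.prems by (intro Suc.IH smooth_within_imp(2)) (auto simp: flat_Suc)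
  then have "flat n (D (\<lambda>x. f x + g x)) x"
    by (simp only: flat_cong[OF Suc.prems(3) eq])
  then show ?case using Suc.prems by (simp add: flat_Suc)
qed (simp add: flat_def)

text \<open>In the product rule \<open>D f\<close> is flat to order \<open>n\<close> by the
  recursion, and \<open>f\<close> itself by monotonicity; \<open>h\<close> is generalised because
  its derivative takes its place.\<close>

lemma flat_mult:
  "smooth_within I h \<Longrightarrow> smooth_within I f \<Longrightarrow> x \<in> I \<Longrightarrow> flat n f x \<Longrightarrow>
    flat n (\<lambda>x. h x * f x) x"
proof (induction n arbitrary: h f)
  case (Suc n)
  have eq: "D (\<lambda>x. h x * f x) y = h y * D f y + D h y * f y" if "y \<in> I" for y
    by (rule D_eqI[OF that])
      (intro has_vector_derivative_mult deriv_on_works smooth_within_imp(1) Suc.prems that)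
  have "flat n (\<lambda>x. h x * D f x + D h x * f x) x"
    using Suc.prems
    by (intro flat_add Suc.IH smooth_mult smooth_within_imp(2))
      (use flat_mono[of "Suc n" f x n] in \<open>auto simp: flat_Suc\<close>)
  then have "flat n (D (\<lambda>x. h x * f x)) x"
    by (simp only: flat_cong[OF Suc.prems(3) eq])
  then show ?case using Suc.prems by (simp add: flat_Suc)
qed (simp add: flat_def)

end

section \<open>Repeated summation by parts\<close>

locale quadratic_phase = compact_interval +
  fixes \<alpha> :: real
  assumes cos_nz: "x \<in> {a..c} \<Longrightarrow> cos (\<alpha> / 2 * x) \<noteq> 0"
begin

text \<open>
  Up to an error of order \<open>1 / k\<close>, the terms \<open>phase k l * f (l / k)\<close> are the differences of
  \<open>bphase k l * primitive f (l / k)\<close>. The half step in \<open>bphase\<close> makes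
  \<open>bphase k (l + 1)\<close> and \<open>bphase k l\<close> equal to \<open>- cis (\<alpha> / 2 * x)\<close> and \<open>cis (- \<alpha> / 2 * x)\<close> times
  \<open>phase k l\<close>, where \<open>x = l / k\<close>, so that no corrections in \<open>1 / k\<close> appear; \<open>resid q f\<close>
  collects the error of order \<open>k\<^sup>-\<^sup>q\<close>.
\<close>

definition primitive :: "(real \<Rightarrow> complex) \<Rightarrow> real \<Rightarrow> complex" where
  "primitive f x = - f x * inverse (cis (\<alpha> / 2 * x) + cis (- \<alpha> / 2 * x))"

definition resid :: "nat \<Rightarrow> (real \<Rightarrow> complex) \<Rightarrow> real \<Rightarrow> complex" where
  "resid q f x = (1 / fact q * cis (\<alpha> / 2 * x)) * (D ^^ q) (primitive f) x"

text \<open>The minus sign is that of the lower end of a telescoping sum. The residual of order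
  \<open>Suc q\<close> comes with \<open>Suc q\<close> powers of \<open>1 / k\<close>, which leaves
  order \<open>m - q\<close> for its own expansion.\<close>

fun coef :: "nat \<Rightarrow> (real \<Rightarrow> complex) \<Rightarrow> real \<Rightarrow> complex" where
  "coef 0 f x = - primitive f x"
| "coef (Suc m) f x = (\<Sum>q\<le>m. coef (m - q) (resid (Suc q) f) x)"

text \<open>The alternating sign is absorbed into the angle, so that negative indices are covered
  too.\<close>

definition phase :: "real \<Rightarrow> real \<Rightarrow> complex" where
  "phase k l = cis (pi * l + \<alpha> / 2 * l\<^sup>2 / k)"

definition bphase :: "real \<Rightarrow> real \<Rightarrow> complex" where
  "bphase k l = cis (pi * l + \<alpha> / 2 * (l\<^sup>2 - l) / k)"

text \<open>The imaginary parts cancel, and the sum is twice the cosine from the locale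
  assumption.\<close>

lemma denom_nz: "x \<in> I \<Longrightarrow> cis (\<alpha> / 2 * x) + cis (- \<alpha> / 2 * x) \<noteq> 0"
  using cos_nz[of x] by (auto simp: complex_eq_iff)

lemma smooth_primitive_factor:
  "smooth_within I (\<lambda>x. - inverse (cis (\<alpha> / 2 * x) + cis (- \<alpha> / 2 * x)))"
proof -
  have "smooth_within I (\<lambda>x. inverse (1 * cis (\<alpha> / 2 * x) + 1 * cis (- \<alpha> / 2 * x)))"
    by (intro smooth_inverse smooth_add smooth_exp) (unfold mult_1, rule denom_nz)
  from smooth_mult[OF smooth_const[of "-1"] this] show ?thesis by simp
qed

lemma primitive_eq:
  "primitive f = (\<lambda>x. - inverse (cis (\<alpha> / 2 * x) + cis (- \<alpha> / 2 * x)) * f x)"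
  by (simp add: primitive_def fun_eq_iff mult.commute)

lemma smooth_primitive: "smooth_within I f \<Longrightarrow> smooth_within I (primitive f)"
  unfolding primitive_eq by (rule smooth_mult[OF smooth_primitive_factor])

lemma smooth_resid: "smooth_within I f \<Longrightarrow> smooth_within I (resid q f)"
  unfolding resid_def by (intro smooth_mult smooth_exp smooth_within_deriv_on smooth_primitive)

text \<open>Keeps the upper boundary terms zero at every stage of the iteration.\<close>

lemma resid_zero:
  assumes "smooth_within I f" "a \<le> r" "r < c" "\<And>x. x \<in> {r..c} \<Longrightarrow> f x = 0" "x \<in> {r..c}"
  shows "resid q f x = 0"
proof -
  have "(D ^^ q) (primitive f) x = 0"
    by (rule derivs_zero_subinterval[OF smooth_primitive[OF assms(1)] assms(2,3) order_refl _ assms(5)])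
      (simp add: primitive_def assms(4))
  then show ?thesis by (simp add: resid_def)
qed

text \<open>Multiplication by a smooth factor preserves flatness, and \<open>Suc q\<close>
  derivatives lower its order by \<open>Suc q\<close>, exactly as the recursion lowers the index of
  the coefficient.\<close>

lemma flat_coef:
  "smooth_within I f \<Longrightarrow> x \<in> I \<Longrightarrow> flat n f x \<Longrightarrow> m < n \<Longrightarrow> coef m f x = 0"
proof (induction m arbitrary: f n rule: less_induct)
  case (less m)
  have fl: "flat n (primitive f) x"
    unfolding primitive_eq by (rule flat_mult[OF smooth_primitive_factor less.prems(1-3)])
  show ?case
  proof (cases m)
    case 0
    with fl less.prems(4) show ?thesis by (auto simp: flat_def)
  next
    case (Suc m')
    have "coef (m' - q) (resid (Suc q) f) x = 0" if "q \<le> m'" for q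
    proof (rule less.IH)
      show "flat (n - Suc q) (resid (Suc q) f) x"
        unfolding resid_def
        by (intro flat_mult smooth_exp smooth_within_deriv_on smooth_primitive less.prems
            flat_funpow fl)
    qed (use Suc that less.prems smooth_resid in auto)
    then show ?thesis using Suc by simp
  qed
qed

text \<open>If both values of \<open>primitive f\<close> are taken at \<open>l / k\<close>, the
  boundary difference is exactly the summand, since the two unit factors add up to the denominator.
  The last term corrects for the shifted argument.\<close>

lemma phase_telescope:
  assumes "k > 0" "l / k \<in> I"
  shows "phase k l * f (l / k) = bphase k (l + 1) * primitive f ((l + 1) / k)
    - bphase k l * primitive f (l / k)
    + phase k l * cis (\<alpha> / 2 * (l / k)) * (primitive f ((l + 1) / k) - primitive f (l / k))"
proof -
  define x where "x = l / k"
  have "pi * (l + 1) + \<alpha> / 2 * ((l + 1)\<^sup>2 - (l + 1)) / k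
      = pi + ((pi * l + \<alpha> / 2 * l\<^sup>2 / k) + \<alpha> / 2 * (l / k))"
    using assms(1) by (simp add: field_simps power2_eq_square)
  then have b1: "bphase k (l + 1) = - phase k l * cis (\<alpha> / 2 * x)"
    by (simp add: bphase_def phase_def x_def flip: cis_mult)
  have "pi * l + \<alpha> / 2 * (l\<^sup>2 - l) / k = (pi * l + \<alpha> / 2 * l\<^sup>2 / k) + - \<alpha> / 2 * (l / k)"
    using assms(1) by (simp add: field_simps power2_eq_square)
  then have b0: "bphase k l = phase k l * cis (- \<alpha> / 2 * x)"
    by (simp only: bphase_def phase_def x_def cis_mult)
  have "f x = - w * (- f x * inverse w)" if "w \<noteq> 0" for w
    using that by simp
  from this[OF denom_nz[OF assms(2)[folded x_def]]]
  have fx: "f x = - (cis (\<alpha> / 2 * x) + cis (- \<alpha> / 2 * x)) * primitive f x"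
    unfolding primitive_def .
  then show ?thesis
    unfolding b0 b1 x_def[symmetric] fx by (simp add: algebra_simps)
qed

lemma norm_phase [simp]: "norm (phase k l) = 1"
  by (simp add: phase_def)

text \<open>The recursion for \<open>coef\<close> summed against powers of \<open>e\<close>, with
  the double sum reindexed over the triangle \<open>q + m < n\<close>. This is the shape in which
  the residual sums appear.\<close>

lemma coef_sum_Suc:
  fixes e :: complex
  shows "(\<Sum>m<Suc n. coef m f x * e ^ m)
    = - primitive f x + (\<Sum>q<n. e ^ Suc q * (\<Sum>m<n - q. coef m (resid (Suc q) f) x * e ^ m))"
proof -
  have "(\<Sum>m<n. coef (Suc m) f x * e ^ Suc m)
      = (\<Sum>m<n. \<Sum>q\<le>m. e ^ Suc q * (coef (m - q) (resid (Suc q) f) x * e ^ (m - q)))"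
  proof (rule sum.cong)
    fix m
    have "e ^ Suc m = e ^ Suc q * e ^ (m - q)" if "q \<le> m" for q
      using that by (simp flip: power_add)
    then show "coef (Suc m) f x * e ^ Suc m
        = (\<Sum>q\<le>m. e ^ Suc q * (coef (m - q) (resid (Suc q) f) x * e ^ (m - q)))"
      by (simp only: coef.simps sum_distrib_right) (rule sum.cong, auto simp: mult_ac)
  qed simp
  also have "\<dots> = (\<Sum>(q, m)\<in>{(q, m). q + m < n}.
      e ^ Suc q * (coef m (resid (Suc q) f) x * e ^ m))"
    by (rule sum.triangle_reindex[symmetric])
  also have "{(q, m). q + m < n} = Sigma {..<n} (\<lambda>q. {..<n - q})"
    by auto
  also have "(\<Sum>(q, m)\<in>Sigma {..<n} (\<lambda>q. {..<n - q}).
      e ^ Suc q * (coef m (resid (Suc q) f) x * e ^ m))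
      = (\<Sum>q<n. e ^ Suc q * (\<Sum>m<n - q. coef m (resid (Suc q) f) x * e ^ m))"
    by (simp add: sum.Sigma[symmetric] sum_distrib_left)
  finally show ?thesis
    by (simp only: sum.lessThan_Suc_shift) simp
qed

section \<open>Expansion at the left endpoint and its error\<close>

definition osc_sum :: "(real \<Rightarrow> complex) \<Rightarrow> real \<Rightarrow> real \<Rightarrow> nat \<Rightarrow> complex" where
  "osc_sum f k p M = (\<Sum>j<M. phase k (p + real j) * f ((p + real j) / k))"

text \<open>Only the lower end contributes, because the sums to be expanded stop where
  \<open>f\<close> vanishes.\<close>

definition expansion_error :: "nat \<Rightarrow> (real \<Rightarrow> complex) \<Rightarrow> real \<Rightarrow> real \<Rightarrow> nat \<Rightarrow> complex" where
  "expansion_error N f k p M = osc_sum f k p M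
     - bphase k p * (\<Sum>m<N. coef m f (p / k) * of_real (1 / k) ^ m)"

definition taylor_rem :: "nat \<Rightarrow> (real \<Rightarrow> complex) \<Rightarrow> real \<Rightarrow> real \<Rightarrow> complex" where
  "taylor_rem N f x y = f y - (\<Sum>q<N. of_real ((y - x) ^ q / fact q) * (D ^^ q) f x)"

text \<open>The telescoping identity is summed, and the increments of \<open>primitive f\<close> are
  expanded by Taylor's formula with step \<open>1 / k\<close>. The upper boundary term is zero by
  the assumption on \<open>f\<close>.\<close>

lemma osc_sum_step:
  fixes k p :: real and M :: nat
  assumes k: "k > 0" and p: "a * k \<le> p" "p + M \<le> c * k" and z: "f ((p + M) / k) = 0"
  shows "osc_sum f k p M = - bphase k p * primitive f (p / k)
    + (\<Sum>q<n. of_real (1 / k) ^ Suc q * osc_sum (resid (Suc q) f) k p M)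
    + (\<Sum>j<M. phase k (p + j) * cis (\<alpha> / 2 * ((p + j) / k))
          * taylor_rem (Suc n) (primitive f) ((p + j) / k) ((p + Suc j) / k))"
proof -
  let ?u = "\<lambda>j::nat. bphase k (p + j) * primitive f ((p + j) / k)"
  let ?x = "\<lambda>j::nat. (p + j) / k"
  let ?T = "\<lambda>j::nat. taylor_rem (Suc n) (primitive f) (?x j) (?x (Suc j))"
  \<comment> \<open>The Taylor term of order zero cancels against the subtracted value, so the sum
    starts at order one.\<close>
  have diff: "primitive f (?x (Suc j)) - primitive f (?x j)
      = (\<Sum>q<n. of_real (1 / k) ^ Suc q * (1 / fact (Suc q)) * (D ^^ Suc q) (primitive f) (?x j)) + ?T j"
    for j
  proof -
    have "?x (Suc j) - ?x j = 1 / k" by (simp add: diff_divide_distrib[symmetric])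
    then show ?thesis
      unfolding taylor_rem_def sum.lessThan_Suc_shift by (simp add: divide_simps)
  qed
  have "phase k (p + j) * f (?x j) = (?u (Suc j) - ?u j)
      + (\<Sum>q<n. of_real (1 / k) ^ Suc q * (phase k (p + j) * resid (Suc q) f (?x j)))
      + phase k (p + j) * cis (\<alpha> / 2 * ?x j) * ?T j" if "j < M" for j
  proof -
    have "?x j \<in> I" using k p that by (auto simp: field_simps intro: order_trans)
    have e: "p + real j + 1 = p + real (Suc j)" by simp
    from phase_telescope[OF k \<open>?x j \<in> I\<close>, of f, unfolded e]
    have "phase k (p + j) * f (?x j) = (?u (Suc j) - ?u j)
      + phase k (p + j) * cis (\<alpha> / 2 * ?x j) * (primitive f (?x (Suc j)) - primitive f (?x j))" .
    then show ?thesis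
      unfolding diff by (simp only: resid_def distrib_left sum_distrib_left add.assoc)
        (simp add: mult_ac)
  qed
  then have "osc_sum f k p M = (\<Sum>j<M. (?u (Suc j) - ?u j)
      + (\<Sum>q<n. of_real (1 / k) ^ Suc q * (phase k (p + j) * resid (Suc q) f (?x j)))
      + phase k (p + j) * cis (\<alpha> / 2 * ?x j) * ?T j)"
    unfolding osc_sum_def by (intro sum.cong) auto
  also have "\<dots> = (\<Sum>j<M. ?u (Suc j) - ?u j)
      + (\<Sum>q<n. of_real (1 / k) ^ Suc q * osc_sum (resid (Suc q) f) k p M)
      + (\<Sum>j<M. phase k (p + j) * cis (\<alpha> / 2 * ?x j) * ?T j)"
    unfolding sum.distrib osc_sum_def sum_distrib_left by (subst sum.swap) (rule refl)
  also have "(\<Sum>j<M. ?u (Suc j) - ?u j) = ?u M - ?u 0"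
    by (rule sum_lessThan_telescope)
  also have "?u M = 0" using z by (simp add: primitive_def)
  finally show ?thesis by simp
qed

text \<open>The leading coefficient cancels the boundary term, and each residual sum is paired with
  its own expansion of order \<open>n - q\<close>.\<close>

lemma expansion_error_step:
  fixes k p :: real and M :: nat
  assumes k: "k > 0" and p: "a * k \<le> p" "p + M \<le> c * k" and z: "f ((p + M) / k) = 0"
  shows "expansion_error (Suc n) f k p M =
    (\<Sum>q<n. of_real (1 / k) ^ Suc q * expansion_error (n - q) (resid (Suc q) f) k p M)
    + (\<Sum>j<M. phase k (p + j) * cis (\<alpha> / 2 * ((p + j) / k))
          * taylor_rem (Suc n) (primitive f) ((p + j) / k) ((p + Suc j) / k))"
  unfolding expansion_error_def osc_sum_step[where f = f, OF assms, of n] coef_sum_Suc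
    right_diff_distrib sum_subtractf
  by (simp add: algebra_simps sum_distrib_left)

text \<open>
  The factor \<open>k\<close> comes from the trivial bound on the number of terms. It is harmless, since
  \<open>N\<close> can be increased by one.
\<close>

lemma expansion_error_bound:
  assumes r: "a \<le> r" "r < c"
  shows "smooth_within I f \<Longrightarrow> (\<And>x. x \<in> {r..c} \<Longrightarrow> f x = 0) \<Longrightarrow>
    \<exists>K\<ge>0. \<forall>(k::real) (p::real) (M::nat). k > 0 \<longrightarrow> a * k \<le> p \<longrightarrow> r * k \<le> p + real M \<longrightarrow> p + real M \<le> c * k \<longrightarrow>
      norm (expansion_error N f k p M) \<le> K * k * (1 / k) ^ N"
proof (induction N arbitrary: f rule: less_induct)
  case (less N)
  have M_le: "real M \<le> (c - a) * k" if "a * k \<le> p" "p + real M \<le> c * k" for k p :: real and M :: nat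
    using that by (simp add: algebra_simps)
  show ?case
  proof (cases N)
    \<comment> \<open>No coefficient is subtracted at order zero, and the number of terms times a
      bound of \<open>f\<close> suffices.\<close>
    case 0
    obtain K where K: "K \<ge> 0" "\<And>x. x \<in> I \<Longrightarrow> norm (f x) \<le> K"
      using smooth_bounded[OF less.prems(1)] by blast
    have "norm (expansion_error N f k p M) \<le> K * (c - a) * k * (1 / k) ^ N"
      if *: "k > 0" "a * k \<le> p" "p + real M \<le> c * k" for k p :: real and M :: nat
    proof -
      have "norm (expansion_error N f k p M) \<le> (\<Sum>j<M. norm (phase k (p + j) * f ((p + j) / k)))"
        by (simp add: 0 expansion_error_def osc_sum_def norm_sum)
      also have "\<dots> \<le> (\<Sum>j<M. K)"
      proof (rule sum_mono)
        fix j assume "j \<in> {..<M}"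
        then have "(p + j) / k \<in> I" using * by (auto simp: field_simps intro: order_trans)
        then show "norm (phase k (p + j) * f ((p + j) / k)) \<le> K"
          using K by (simp add: norm_mult)
      qed
      also have "\<dots> = K * M" by simp
      also have "\<dots> \<le> K * ((c - a) * k)" using M_le * K by (intro mult_left_mono) auto
      finally show ?thesis by (simp add: 0 mult_ac)
    qed
    then show ?thesis using K ac by (intro exI[of _ "K * (c - a)"]) auto
  next
    case (Suc n)
    have "\<exists>K\<ge>0. \<forall>(k::real) (p::real) (M::nat). k > 0 \<longrightarrow> a * k \<le> p \<longrightarrow> r * k \<le> p + real M \<longrightarrow> p + real M \<le> c * k \<longrightarrow>
      norm (expansion_error (n - q) (resid (Suc q) f) k p M) \<le> K * k * (1 / k) ^ (n - q)" for q
      by (rule less.IH) (use Suc smooth_resid[OF less.prems(1)]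
        resid_zero[OF less.prems(1) r less.prems(2)] in auto)
    then obtain K where K: "\<And>q. K q \<ge> 0" "\<And>q k p M. k > 0 \<Longrightarrow> a * k \<le> p \<Longrightarrow>
        r * k \<le> p + real M \<Longrightarrow> p + real M \<le> c * k \<Longrightarrow>
        norm (expansion_error (n - q) (resid (Suc q) f) k p M) \<le> K q * k * (1 / k) ^ (n - q)"
      by metis
    obtain L where L: "L \<ge> 0" "\<And>x y. a \<le> x \<Longrightarrow> x \<le> y \<Longrightarrow> y \<le> c \<Longrightarrow>
        norm (taylor_rem (Suc n) (primitive f) x y) \<le> L * (y - x) ^ Suc n"
      unfolding taylor_rem_def
      using taylor_remainder[OF smooth_primitive[OF less.prems(1)], of "Suc n"] by blast
    have "norm (expansion_error N f k p M) \<le> ((\<Sum>q<n. K q) + L * (c - a)) * k * (1 / k) ^ N"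
      if *: "k > 0" "a * k \<le> p" "r * k \<le> p + real M" "p + real M \<le> c * k" for k p :: real and M :: nat
    proof -
      have z: "f ((p + M) / k) = 0"
        using * by (intro less.prems(2)) (simp add: field_simps)
      have "norm (expansion_error N f k p M)
          \<le> (\<Sum>q<n. norm (of_real (1 / k) ^ Suc q * expansion_error (n - q) (resid (Suc q) f) k p M))
          + (\<Sum>j<M. norm (phase k (p + j) * cis (\<alpha> / 2 * ((p + j) / k))
            * taylor_rem (Suc n) (primitive f) ((p + j) / k) ((p + Suc j) / k)))"
        unfolding Suc expansion_error_step[where f = f, OF *(1,2,4) z]
        by (intro order_trans[OF norm_triangle_ineq] add_mono norm_sum)
      also have "\<dots> \<le> (\<Sum>q<n. K q * k * (1 / k) ^ N) + (\<Sum>j<M. L * (1 / k) ^ N)"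
      proof (intro add_mono sum_mono)
        fix q assume q: "q \<in> {..<n}"
        have "norm (of_real (1 / k) ^ Suc q * expansion_error (n - q) (resid (Suc q) f) k p M)
            = (1 / k) ^ Suc q * norm (expansion_error (n - q) (resid (Suc q) f) k p M)"
          using *(1) by (simp add: norm_mult norm_power norm_divide)
        also have "\<dots> \<le> (1 / k) ^ Suc q * (K q * k * (1 / k) ^ (n - q))"
          using * by (intro mult_left_mono K) auto
        also have "\<dots> = K q * k * ((1 / k) ^ Suc q * (1 / k) ^ (n - q))"
          by (simp only: mult_ac)
        \<comment> \<open>The prefactor makes up for the lower order of the expansion of the
          residual.\<close>
        also have "(1 / k) ^ Suc q * (1 / k) ^ (n - q) = (1 / k) ^ N"
          unfolding power_add[symmetric] using q Suc by simp
        finally show "norm (of_real (1 / k) ^ Suc q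
            * expansion_error (n - q) (resid (Suc q) f) k p M) \<le> K q * k * (1 / k) ^ N" .
      next
        fix j assume j: "j \<in> {..<M}"
        have xy: "a \<le> (p + j) / k" "(p + j) / k \<le> (p + Suc j) / k" "(p + Suc j) / k \<le> c"
          using * j by (auto simp: field_simps)
        have d: "(p + Suc j) / k - (p + j) / k = 1 / k"
          by (simp add: diff_divide_distrib[symmetric])
        show "norm (phase k (p + j) * cis (\<alpha> / 2 * ((p + j) / k))
            * taylor_rem (Suc n) (primitive f) ((p + j) / k) ((p + Suc j) / k)) \<le> L * (1 / k) ^ N"
          using L(2)[OF xy] unfolding d Suc by (simp add: norm_mult)
      qed
      also have "\<dots> = (\<Sum>q<n. K q) * k * (1 / k) ^ N + M * (L * (1 / k) ^ N)"
        by (simp add: sum_distrib_right)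
      \<comment> \<open>The number of summands is at most the length of the interval times
        \<open>k\<close>.\<close>
      also have "M * (L * (1 / k) ^ N) \<le> ((c - a) * k) * (L * (1 / k) ^ N)"
        using M_le * L by (intro mult_right_mono) auto
      finally show ?thesis by (simp add: algebra_simps)
    qed
    moreover have "(\<Sum>q<n. K q) + L * (c - a) \<ge> 0"
      using K(1) L(1) ac by (simp add: sum_nonneg)
    ultimately show ?thesis by blast
  qed
qed

end

section \<open>Functions on the half-line\<close>

lemma half_line_has_vector_derivative:
  assumes "half_line_smooth f" "x \<ge> 0"
  shows "(half_line_deriv j f has_vector_derivative half_line_deriv (Suc j) f x) (at x within {0..})"
proof -
  have "half_line_deriv j f differentiable (at x within {0..})"
    using assms by (simp add: half_line_smooth_def differentiable_on_def)
  then show ?thesis by (simp add: vector_derivative_works half_line_deriv_def)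
qed

lemma half_line_deriv_0: "half_line_deriv 0 f = f"
  by (simp add: half_line_deriv_def)

lemma half_line_smooth_interval:
  assumes "half_line_smooth f" "0 < c"
  shows "smooth_within {0..c} f"
    and "x \<in> {0..c} \<Longrightarrow> (deriv_on {0..c} ^^ j) f x = half_line_deriv j f x"
proof -
  interpret compact_interval 0 c by unfold_locales (fact assms(2))
  have der: "(half_line_deriv j f has_vector_derivative half_line_deriv (Suc j) f x) (at x within I)"
    if "x \<in> I" for j x
    by (rule has_vector_derivative_within_subset[OF half_line_has_vector_derivative[OF assms(1)]])
      (use that in auto)
  show "smooth_within {0..c} f"
    using jet(1)[where F = "\<lambda>j. half_line_deriv j f" and j = 0, OF der]
    unfolding half_line_deriv_0 by simp
  show "x \<in> {0..c} \<Longrightarrow> (deriv_on {0..c} ^^ j) f x = half_line_deriv j f x"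
    using jet(2)[where F = "\<lambda>j. half_line_deriv j f", OF der] unfolding half_line_deriv_0 by simp
qed

text \<open>The derivatives on both sides are explicit: reflection contributes the sign
  \<open>(- 1) ^ j\<close>. They agree at the origin because the odd ones vanish there, so they glue
  to a chain as in \<open>jet\<close>.\<close>

lemma half_line_smooth_even_extension:
  assumes f: "half_line_smooth f" and "0 < c" and odd_zero: "\<And>j. odd j \<Longrightarrow> half_line_deriv j f 0 = 0"
  shows "smooth_within {-c..c} (\<lambda>x. f \<bar>x\<bar>)"
proof -
  interpret compact_interval "-c" c by unfold_locales (use assms(2) in simp)
  define F where "F j x = (if x \<in> {0..c} then half_line_deriv j f x
    else (- 1) ^ j * half_line_deriv j f (- x))" for j x
  have "(F j has_vector_derivative F (Suc j) x) (at x within I)" if x: "x \<in> I" for j x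
    unfolding F_def
  proof (rule has_vector_derivative_If_within_closures[where T = "{-c..0}"])
    show "x \<in> {0..c} \<union> {-c..0}" "{-c..c} = {0..c} \<union> {-c..0}" using x \<open>0 < c\<close> by auto
    have cl: "closure {0..c} \<inter> closure {-c..0} = {0}" using \<open>0 < c\<close> by auto
    show "(half_line_deriv j f has_vector_derivative half_line_deriv (Suc j) f x)
        (at x within {0..c} \<union> closure {0..c} \<inter> closure {-c..0})"
      if "x \<in> {0..c} \<union> closure {0..c} \<inter> closure {-c..0}"
      by (rule has_vector_derivative_within_subset[OF half_line_has_vector_derivative[OF f]])
        (use that \<open>0 < c\<close> in \<open>auto simp: cl\<close>)
    show "((\<lambda>x. (- 1) ^ j * half_line_deriv j f (- x)) has_vector_derivative
        (- 1) ^ Suc j * half_line_deriv (Suc j) f (- x))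
        (at x within {-c..0} \<union> closure {0..c} \<inter> closure {-c..0})"
      if x: "x \<in> {-c..0} \<union> closure {0..c} \<inter> closure {-c..0}"
    proof -
      have x0: "x \<le> 0" using x by (auto simp: cl)
      have "((half_line_deriv j f \<circ> uminus) has_vector_derivative
          (- 1) *\<^sub>R half_line_deriv (Suc j) f (- x)) (at x within {..0})"
      proof (rule vector_diff_chain_within)
        show "(uminus has_vector_derivative - 1) (at x within {..0})"
          by (auto intro!: derivative_eq_intros)
        show "(half_line_deriv j f has_vector_derivative half_line_deriv (Suc j) f (- x))
            (at (- x) within uminus ` {..0})"
          by (rule has_vector_derivative_within_subset[OF half_line_has_vector_derivative[OF f]])
            (use x0 in auto)
      qed
      then have "((\<lambda>x. (- 1) ^ j * half_line_deriv j f (- x)) has_vector_derivative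
          (- 1) ^ j * ((- 1) *\<^sub>R half_line_deriv (Suc j) f (- x))) (at x within {..0})"
        unfolding o_def by (rule has_vector_derivative_mult_right)
      then show ?thesis
        by (rule has_vector_derivative_within_subset[THEN has_vector_derivative_eq_rhs])
          (auto simp: cl)
    qed
    have sym: "half_line_deriv i f 0 = (- 1) ^ i * half_line_deriv i f (- 0)" for i
      using odd_zero[of i] by (cases "even i") auto
    have x0: "x = 0" if "x \<in> closure {0..c}" "x \<in> closure {-c..0}"
      using that cl by blast
    show "half_line_deriv j f x = (- 1) ^ j * half_line_deriv j f (- x)"
      "half_line_deriv (Suc j) f x = (- 1) ^ Suc j * half_line_deriv (Suc j) f (- x)"
      if "x \<in> closure {0..c}" "x \<in> closure {-c..0}"
      unfolding x0[OF that] by (rule sym)+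
  qed
  then have sm: "smooth_within I (F 0)" by (rule jet(1))
  have F0: "F 0 x = f \<bar>x\<bar>" if "x \<in> I" for x
    using that by (auto simp: F_def half_line_deriv_0)
  show ?thesis by (rule smooth_within_cong[THEN iffD1, OF F0 sm])
qed

text \<open>Once the lower derivatives vanish, Taylor's formula leaves the term of order
  \<open>j\<close> up to \<open>O(y^(j+1))\<close>. Dividing by \<open>y^j\<close> and letting
  \<open>y\<close> tend to 0 forces its coefficient to vanish.\<close>

lemma half_line_deriv_eq_0_of_bigo:
  assumes f: "half_line_smooth f" and O: "f \<in> O[at_right 0](\<lambda>x. of_real x ^ n)"
  shows "j < n \<Longrightarrow> half_line_deriv j f 0 = 0"
proof (induction j rule: less_induct)
  case (less j)
  interpret compact_interval 0 1 by unfold_locales simp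
  note sm = half_line_smooth_interval[OF f zero_less_one]
  obtain K where K: "K \<ge> 0" "\<And>x y. 0 \<le> x \<Longrightarrow> x \<le> y \<Longrightarrow> y \<le> 1 \<Longrightarrow>
      norm (f y - (\<Sum>q<Suc j. of_real ((y - x) ^ q / fact q) * (D ^^ q) f x)) \<le> K * (y - x) ^ Suc j"
    using taylor_remainder[OF sm(1), of "Suc j"] by blast
  obtain C where C: "C > 0" "eventually (\<lambda>x. norm (f x) \<le> C * norm (complex_of_real x ^ n)) (at_right 0)"
    using landau_o.bigE[OF O] by blast
  let ?h = "norm (half_line_deriv j f 0) / fact j"
  have "eventually (\<lambda>y. y \<in> {0<..<1::real}) (at_right 0)"
    by (rule eventually_at_right_real) simp
  with C(2) have "eventually (\<lambda>y. ?h \<le> (K + C) * y) (at_right 0)"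
  proof eventually_elim
    case (elim y)
    then have y: "0 < y" "y < 1" by auto
    have "(\<Sum>q<Suc j. of_real ((y - 0) ^ q / fact q) * (D ^^ q) f 0)
        = of_real (y ^ j / fact j) * half_line_deriv j f 0"
      using less sm(2) by simp
    then have "norm (f y - of_real (y ^ j / fact j) * half_line_deriv j f 0) \<le> K * y ^ Suc j"
      using K(2)[of 0 y] y by simp
    moreover have "norm (of_real (y ^ j / fact j) * half_line_deriv j f 0) = ?h * y ^ j"
      using y by (simp add: norm_mult norm_power norm_divide)
    moreover have "norm (f y) \<le> C * y ^ Suc j"
    proof -
      have "norm (f y) \<le> C * y ^ n" using elim y by (simp add: norm_power)
      \<comment> \<open>Uses \<open>y < 1\<close> and \<open>Suc j \<le> n\<close>.\<close>
      also have "\<dots> \<le> C * y ^ Suc j"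
        using less.prems y C by (intro mult_left_mono power_decreasing) auto
      finally show ?thesis .
    qed
    ultimately have "?h * y ^ j \<le> (K + C) * y ^ Suc j"
      using norm_triangle_ineq2[of "of_real (y ^ j / fact j) * half_line_deriv j f 0" "f y"]
      by (simp add: norm_minus_commute algebra_simps)
    then have "?h * y ^ j \<le> ((K + C) * y) * y ^ j" by (simp add: mult_ac)
    then show ?case using y by (subst (asm) mult_le_cancel_right) auto
  qed
  moreover have "((\<lambda>y. (K + C) * y) \<longlongrightarrow> (K + C) * 0) (at_right 0)"
    by (intro tendsto_intros)
  ultimately have "?h \<le> (K + C) * 0"
    by (intro tendsto_lowerbound[of "\<lambda>y. (K + C) * y"]) auto
  then show ?case by (simp add: pos_divide_le_eq)
qed

lemma half_line_support_bound:
  assumes "compact (half_line_support f)" "half_line_support f \<subseteq> {0..<b}" "0 < b"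
  obtains r where "0 \<le> r" "r < b" "\<And>x. x \<ge> r \<Longrightarrow> f x = 0"
proof -
  obtain s where s: "s < b" "\<And>x. x \<in> half_line_support f \<Longrightarrow> x \<le> s"
  proof (cases "half_line_support f = {}")
    case True
    then show ?thesis using that[of 0] assms by auto
  next
    case False
    from compact_attains_sup[OF assms(1) this] obtain s
      where s: "s \<in> half_line_support f" "\<And>x. x \<in> half_line_support f \<Longrightarrow> x \<le> s" by blast
    show ?thesis by (rule that[OF _ s(2)]) (use s(1) assms(2) in auto)
  qed
  \<comment> \<open>The midpoint lies strictly above \<open>s\<close>, so that \<open>f\<close>
    vanishes at it as well, and strictly below \<open>b\<close>.\<close>
  have "f x = 0" if x: "x \<ge> (max s 0 + b) / 2" for x
  proof (rule ccontr)
    assume "f x \<noteq> 0"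
    moreover have "x > max s 0" using x s(1) assms(3) by (auto simp: max_def split: if_splits)
    ultimately have "x \<in> half_line_support f"
      unfolding half_line_support_def by (intro subsetD[OF closure_subset]) auto
    then show False using s(2) \<open>x > max s 0\<close> by force
  qed
  then show ?thesis using that[of "(max s 0 + b) / 2"] s(1) assms(3) by auto
qed

section \<open>The alternating sum\<close>

text \<open>The argument lies strictly between \<open>- pi / 2\<close> and \<open>pi / 2\<close>;
  this is where the radius \<open>pi / \<bar>\<alpha>\<bar>\<close> matters.\<close>

lemma cos_half_nonzero:
  assumes "\<bar>x\<bar> < pi / \<bar>\<alpha>\<bar>" "\<alpha> \<noteq> 0"
  shows "cos (\<alpha> / 2 * x) \<noteq> 0"
proof -
  have "\<bar>\<alpha>\<bar> * \<bar>x\<bar> < pi" using assms by (simp add: field_simps)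
  then have "\<bar>\<alpha> * x\<bar> < pi" by (simp add: abs_mult)
  then have "cos (\<alpha> / 2 * x) > 0" by (intro cos_gt_zero_pi) auto
  then show ?thesis by simp
qed

lemma cis_pi_nat: "cis (pi * real l) = (- 1) ^ l"
proof -
  have "cis (pi * real l) = cis pi ^ l" by (simp only: Complex.DeMoivre mult.commute)
  then show ?thesis by (simp only: cis_pi)
qed

lemma sum_lessThan_add:
  fixes g :: "nat \<Rightarrow> 'a::comm_monoid_add"
  shows "(\<Sum>j<m + n. g j) = (\<Sum>j<m. g j) + (\<Sum>j<n. g (m + j))"
  by (induction n) (auto simp: add.assoc)

context quadratic_phase
begin

lemma phase_nat: "phase k (real l) = (- 1) ^ l * exp (\<i> * of_real (\<alpha> / 2 * (real l)\<^sup>2 / k))"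
  by (simp only: phase_def cis_mult[symmetric] cis_pi_nat) (simp add: cis_conv_exp)

lemma phase_0: "phase k 0 = 1"
  by (simp add: phase_def)

text \<open>The square is even, and for an integer index the sign factor is real, hence unchanged by
  conjugation.\<close>

lemma phase_minus: "phase k (- real l) = phase k (real l)"
proof -
  have "cis (pi * (- real l)) = cnj (cis (pi * real l))" by (simp add: cis_cnj)
  also have "\<dots> = cis (pi * real l)" by (simp add: cis_pi_nat)
  finally show ?thesis by (simp only: phase_def cis_mult[symmetric] power2_minus)
qed

text \<open>All terms from index \<open>Suc M\<close> on vanish. The sum from 0 counts
  \<open>f 0\<close> fully, whereas \<open>S_minus\<close> counts it by half.\<close>

lemma S_minus_eq_osc_sum:
  assumes "k > 0" "r * real k \<le> real (Suc M)" "\<And>x. x \<ge> r \<Longrightarrow> f x = 0"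
  shows "S_minus \<alpha> f k = osc_sum f k 0 (Suc M) - f 0 / 2"
proof -
  let ?t = "\<lambda>l. phase k (real l) * f (real l / real k)"
  have "S_minus \<alpha> f k = f 0 / 2 + (\<Sum>m. ?t (Suc m))"
    by (simp only: S_minus_def phase_nat Let_def)
  also have "(\<Sum>m. ?t (Suc m)) = (\<Sum>m<M. ?t (Suc m))"
  proof (rule suminf_finite)
    fix m assume "m \<notin> {..<M}"
    then have "r * real k \<le> real (Suc m)" using assms(2) by simp
    then have "r \<le> real (Suc m) / real k" using assms(1) by (simp add: field_simps)
    then show "?t (Suc m) = 0" using assms(3) by simp
  qed simp
  also have "\<dots> = osc_sum f k 0 (Suc M) - f 0"
    unfolding osc_sum_def sum.lessThan_Suc_shift by (simp add: phase_0)
  finally show ?thesis by simp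
qed

text \<open>The indices run from \<open>- M\<close> to \<open>M - 1\<close>. The negative ones
  reflect to \<open>1, ..., M\<close>, where the term at \<open>M\<close> is zero, so only the term
  at 0 is not doubled.\<close>

lemma osc_sum_symmetric:
  assumes even: "\<And>x. F x = f \<bar>x\<bar>" and z: "f (real M / k) = 0" and "k > 0"
  shows "osc_sum F k (- real M) (M + M) = 2 * osc_sum f k 0 M - f 0"
proof -
  let ?t = "\<lambda>l. phase k (real l) * f (real l / k)"
  have "(\<Sum>j<M. phase k (- real M + real j) * F ((- real M + real j) / k)) = (\<Sum>j<M. ?t (Suc (M - Suc j)))"
  proof (rule sum.cong)
    fix j assume j: "j \<in> {..<M}"
    define l where "l = Suc (M - Suc j)"
    have e: "- real M + real j = - real l" using j by (simp add: l_def)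
    have "\<bar>- real l / k\<bar> = real l / k" using \<open>k > 0\<close> by simp
    then show "phase k (- real M + real j) * F ((- real M + real j) / k) = ?t (Suc (M - Suc j))"
      unfolding e even phase_minus l_def[symmetric] by (simp only:)
  qed simp
  also have "\<dots> = (\<Sum>j<M. ?t (Suc j))" by (rule sum.nat_diff_reindex[of "\<lambda>j. ?t (Suc j)"])
  also have "\<dots> = (\<Sum>j<M. ?t j) - f 0"
  proof -
    have "(\<Sum>j<M. ?t (Suc j)) - (\<Sum>j<M. ?t j) = ?t M - ?t 0"
      unfolding sum_subtractf[symmetric] by (rule sum_lessThan_telescope[of ?t])
    then show ?thesis using z by (simp add: phase_0 algebra_simps)
  qed
  finally have "(\<Sum>j<M. phase k (- real M + real j) * F ((- real M + real j) / k))
      = (\<Sum>j<M. ?t j) - f 0" .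
  moreover have "(\<Sum>j<M. phase k (- real M + real (M + j)) * F ((- real M + real (M + j)) / k))
      = (\<Sum>j<M. ?t j)"
    using \<open>k > 0\<close> by (simp add: even)
  ultimately show ?thesis
    unfolding osc_sum_def sum_lessThan_add by simp
qed

end

text \<open>The interval from \<open>r * k\<close> to \<open>c * k\<close> has length at least 1, so
  the floor of its upper end lies in it; that floor is positive, hence a successor.\<close>

lemma endpoint_exists:
  fixes k :: nat and r c :: real
  assumes "0 \<le> r" "r < c" "1 / (c - r) \<le> k"
  obtains M where "r * k \<le> real (Suc M)" "real (Suc M) \<le> c * k"
proof -
  have k: "1 \<le> c * k - r * k" using assms by (simp add: field_simps)
  have "0 \<le> r * k" using assms(1) by simp
  then have fl: "\<lfloor>c * k\<rfloor> \<ge> 1" using k by simp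
  define M where "M = nat \<lfloor>c * k\<rfloor> - 1"
  have "real (Suc M) = of_int \<lfloor>c * k\<rfloor>" using fl by (simp add: M_def of_nat_diff)
  then show ?thesis using that[of M] k by linarith
qed

section \<open>The two asymptotic statements\<close>

lemma eventually_large_nat:
  assumes "\<And>k::nat. k > 0 \<Longrightarrow> b \<le> real k \<Longrightarrow> P k"
  shows "eventually P at_top"
  using eventually_gt_at_top[of 0] eventually_ge_at_top[of "nat \<lceil>b\<rceil>"]
  by eventually_elim (auto intro!: assms simp: nat_le_iff ceiling_le_iff)

lemma rapidly_decaying_even:
  assumes \<alpha>: "\<alpha> \<noteq> 0" and f: "half_line_smooth f" and r: "0 \<le> r" "r < pi / \<bar>\<alpha>\<bar>"
    and z: "\<And>x. x \<ge> r \<Longrightarrow> f x = 0" and even: "even_at_origin f"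
  shows "rapidly_decaying (S_minus \<alpha> f)"
proof -
  \<comment> \<open>Room beyond \<open>r\<close> gives a nondegenerate interval on which
    \<open>f\<close> vanishes, still inside the region of nonzero cosine.\<close>
  obtain c where "r < c" "c < pi / \<bar>\<alpha>\<bar>"
    using dense[OF r(2)] by blast
  with r(1) have c: "r < c" "c < pi / \<bar>\<alpha>\<bar>" "0 < c" by auto
  define F where "F x = f \<bar>x\<bar>" for x
  interpret quadratic_phase "-c" c \<alpha>
  proof unfold_locales
    show "-c < c" using c by simp
    show "cos (\<alpha> / 2 * x) \<noteq> 0" if "x \<in> {-c..c}" for x
      by (rule cos_half_nonzero[OF _ \<alpha>]) (use that c in auto)
  qed
  have sm: "smooth_within I F"
    unfolding F_def
  proof (rule half_line_smooth_even_extension[OF f c(3)])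
    show "half_line_deriv j f 0 = 0" if "odd j" for j
      using even that unfolding even_at_origin_def taylor_coeff_def by auto
  qed
  \<comment> \<open>There \<open>F\<close> vanishes on a whole interval, hence to every
    order.\<close>
  have coef0: "coef m F x = 0" if x: "x \<in> {-c..-r}" for m x
  proof (rule flat_coef[OF sm _ _ lessI])
    show "x \<in> I" using x r c by auto
    show "flat (Suc m) F x"
      unfolding flat_def
      using derivs_zero_subinterval[OF sm, of "-c" "-r" x] c r x z by (auto simp: F_def)
  qed
  show ?thesis
    unfolding rapidly_decaying_def
  proof
    fix N
    \<comment> \<open>One order more than \<open>N\<close> compensates for the factor
      \<open>k\<close> in the error bound.\<close>
    obtain K where K: "K \<ge> 0" "\<And>(k::real) (p::real) (M::nat). k > 0 \<Longrightarrow> - c * k \<le> p \<Longrightarrow>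
        r * k \<le> p + real M \<Longrightarrow> p + real M \<le> c * k \<Longrightarrow>
        norm (expansion_error (Suc N) F k p M) \<le> K * k * (1 / k) ^ Suc N"
      using expansion_error_bound[OF _ c(1) sm, of "Suc N"] r z c by (auto simp: F_def)
    have "norm (S_minus \<alpha> f k) \<le> K * norm (1 / of_nat k ^ N :: complex)"
      if k: "k > 0" "1 / (c - r) \<le> real k" for k :: nat
    proof -
      obtain M where M: "r * k \<le> real (Suc M)" "real (Suc M) \<le> c * k"
        using endpoint_exists[OF r(1) c(1) k(2)] .
      have fM: "f (real (Suc M) / k) = 0"
        using k M by (intro z) (simp add: field_simps)
      have x: "- real (Suc M) / k \<in> {-c..-r}"
        using k M by (auto simp: field_simps)
      have "expansion_error (Suc N) F k (- real (Suc M)) (Suc M + Suc M)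
          = osc_sum F k (- real (Suc M)) (Suc M + Suc M)"
        by (simp only: expansion_error_def coef0[OF x]) simp
      also have "\<dots> = 2 * S_minus \<alpha> f k"
        using osc_sum_symmetric[of F f "Suc M" k, OF F_def fM] S_minus_eq_osc_sum[OF k(1) M(1) z] k
        by simp
      finally have "norm (2 * S_minus \<alpha> f k) \<le> K * k * (1 / k) ^ Suc N"
        using K(2)[of k "- real (Suc M)" "Suc M + Suc M"] k M by simp
      moreover have "K * k * (1 / k) ^ Suc N = K * (1 / k) ^ N" using k by simp
      ultimately have "2 * norm (S_minus \<alpha> f k) \<le> K * (1 / k) ^ N"
        by (simp add: norm_mult)
      moreover have "norm (S_minus \<alpha> f k) \<ge> 0" by simp
      ultimately have "norm (S_minus \<alpha> f k) \<le> K * (1 / k) ^ N" by linarith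
      then show ?thesis by (simp add: norm_divide norm_power power_one_over)
    qed
    then have "eventually (\<lambda>k. norm (S_minus \<alpha> f k) \<le> K * norm (1 / of_nat k ^ N :: complex)) at_top"
      by (rule eventually_large_nat)
    then show "S_minus \<alpha> f \<in> O(\<lambda>k. 1 / of_nat k ^ N)" by (rule bigoI)
  qed
qed

text \<open>Here the sum starts at the origin, where \<open>bphase\<close> is 1. Flatness of order
  \<open>n\<close> removes the coefficients below index \<open>n\<close>, and the remaining ones are
  shifted by \<open>n\<close>.\<close>

lemma asymptotic_expansion_vanishing:
  assumes \<alpha>: "\<alpha> \<noteq> 0" and f: "half_line_smooth f" and r: "0 \<le> r" "r < pi / \<bar>\<alpha>\<bar>"
    and z: "\<And>x. x \<ge> r \<Longrightarrow> f x = 0" and van: "\<And>j. j < n \<Longrightarrow> half_line_deriv j f 0 = 0"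
  shows "\<exists>d. has_asymptotic_expansion (S_minus \<alpha> f) n d"
proof -
  obtain c where "r < c" "c < pi / \<bar>\<alpha>\<bar>"
    using dense[OF r(2)] by blast
  with r(1) have c: "r < c" "c < pi / \<bar>\<alpha>\<bar>" "0 < c" by auto
  interpret quadratic_phase 0 c \<alpha>
  proof unfold_locales
    show "0 < c" using c by simp
    show "cos (\<alpha> / 2 * x) \<noteq> 0" if "x \<in> {0..c}" for x
      by (rule cos_half_nonzero[OF _ \<alpha>]) (use that c in auto)
  qed
  note sm = half_line_smooth_interval[OF f c(3)]
  \<comment> \<open>The coefficient of index 0 equals \<open>f 0 / 2\<close>, which cancels against
    the half weight of the term at 0; hence it is replaced by zero.\<close>
  define d where "d m = (if m = 0 then 0 else coef m f 0)" for m
  have "flat n f 0" unfolding flat_def using van sm(2) c by simp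
  then have d0: "d m = 0" if "m < n" for m
    using that flat_coef[OF sm(1), of 0 n m] c by (simp add: d_def)
  have "(\<lambda>k. S_minus \<alpha> f k - 1 / of_nat k ^ n * (\<Sum>l<N. 1 / of_nat k ^ l * d (n + l)))
      \<in> O(\<lambda>k. 1 / of_nat k ^ (n + N))" for N
  proof -
    obtain K where K: "K \<ge> 0" "\<And>(k::real) (p::real) (M::nat). k > 0 \<Longrightarrow> 0 * k \<le> p \<Longrightarrow>
        r * k \<le> p + real M \<Longrightarrow> p + real M \<le> c * k \<Longrightarrow>
        norm (expansion_error (Suc (n + N)) f k p M) \<le> K * k * (1 / k) ^ Suc (n + N)"
      using expansion_error_bound[OF r(1) c(1) sm(1), of "Suc (n + N)"] z by auto
    \<comment> \<open>The error is taken at order \<open>Suc (n + N)\<close> to absorb the factor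
      \<open>k\<close>. This includes one coefficient beyond the truncation, whence the summand
      \<open>norm (d (n + N))\<close>.\<close>
    have "norm (S_minus \<alpha> f k - 1 / of_nat k ^ n * (\<Sum>l<N. 1 / of_nat k ^ l * d (n + l)))
        \<le> (K + norm (d (n + N))) * norm (1 / of_nat k ^ (n + N) :: complex)"
      if k: "k > 0" "1 / (c - r) \<le> real k" for k :: nat
    proof -
      let ?e = "complex_of_real (1 / real k)"
      obtain M where M: "r * k \<le> real (Suc M)" "real (Suc M) \<le> c * k"
        using endpoint_exists[OF r(1) c(1) k(2)] .
      have "(\<Sum>m<Suc (n + N). coef m f 0 * ?e ^ m)
          = f 0 / 2 + (\<Sum>m<Suc (n + N). d m * ?e ^ m)"
        unfolding sum.lessThan_Suc_shift by (simp add: d_def primitive_def)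
      also have "(\<Sum>m<Suc (n + N). d m * ?e ^ m) = (\<Sum>l<N. d (n + l) * ?e ^ (n + l)) + d (n + N) * ?e ^ (n + N)"
        using d0 by (simp add: sum_lessThan_add)
      finally have sum: "(\<Sum>m<Suc (n + N). coef m f 0 * ?e ^ m)
          = f 0 / 2 + ((\<Sum>l<N. d (n + l) * ?e ^ (n + l)) + d (n + N) * ?e ^ (n + N))" .
      have S: "S_minus \<alpha> f k = osc_sum f k 0 (Suc M) - f 0 / 2"
        by (rule S_minus_eq_osc_sum[OF k(1) M(1) z])
      have "expansion_error (Suc (n + N)) f k 0 (Suc M) + d (n + N) * ?e ^ (n + N)
          = S_minus \<alpha> f k - (\<Sum>l<N. d (n + l) * ?e ^ (n + l))"
        using sum unfolding expansion_error_def S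
        by (simp add: bphase_def del: sum.lessThan_Suc)
      also have "(\<Sum>l<N. d (n + l) * ?e ^ (n + l))
          = 1 / of_nat k ^ n * (\<Sum>l<N. 1 / of_nat k ^ l * d (n + l))"
        by (simp add: sum_distrib_left power_add power_one_over field_simps)
      finally have eq: "S_minus \<alpha> f k - 1 / of_nat k ^ n * (\<Sum>l<N. 1 / of_nat k ^ l * d (n + l))
          = expansion_error (Suc (n + N)) f k 0 (Suc M) + d (n + N) * ?e ^ (n + N)" by simp
      have "norm (expansion_error (Suc (n + N)) f k 0 (Suc M)) \<le> K * k * (1 / k) ^ Suc (n + N)"
        using K(2)[of k 0 "Suc M"] k M by simp
      also have "\<dots> = K * (1 / k) ^ (n + N)" using k by simp
      finally have "norm (expansion_error (Suc (n + N)) f k 0 (Suc M) + d (n + N) * ?e ^ (n + N))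
          \<le> K * (1 / k) ^ (n + N) + norm (d (n + N)) * (1 / k) ^ (n + N)"
        by (intro order_trans[OF norm_triangle_ineq] add_mono)
          (simp_all add: norm_mult norm_power norm_divide)
      then show ?thesis
        unfolding eq
        by (simp add: norm_divide norm_power power_one_over distrib_right add_divide_distrib)
    qed
    then have "eventually (\<lambda>k. norm (S_minus \<alpha> f k
        - 1 / of_nat k ^ n * (\<Sum>l<N. 1 / of_nat k ^ l * d (n + l)))
        \<le> (K + norm (d (n + N))) * norm (1 / of_nat k ^ (n + N) :: complex)) at_top"
      by (rule eventually_large_nat)
    then show ?thesis by (rule bigoI)
  qed
  then show ?thesis
    unfolding has_asymptotic_expansion_def by (intro exI[of _ "\<lambda>l. d (n + l)"] allI)
qed

theorem theorem4p7:
  fixes \<alpha> :: real and f :: "real \<Rightarrow> complex" and n :: nat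
  assumes "\<alpha> \<noteq> 0"
    and "half_line_test_function f"
    and "half_line_support f \<subseteq> {0..<pi / \<bar>\<alpha>\<bar>}"
  shows "(even_at_origin f \<longrightarrow> rapidly_decaying (S_minus \<alpha> f)) \<and>
         (odd_at_origin f \<and> f \<in> O[at_right 0](\<lambda>x. of_real x ^ n) \<longrightarrow>
            (\<exists>c. has_asymptotic_expansion (S_minus \<alpha> f) n c))"
proof -
  have f: "half_line_smooth f" and cpt: "compact (half_line_support f)"
    using assms(2) by (auto simp: half_line_test_function_def)
  obtain r where r: "0 \<le> r" "r < pi / \<bar>\<alpha>\<bar>" "\<And>x. x \<ge> r \<Longrightarrow> f x = 0"
    using half_line_support_bound[OF cpt assms(3)] assms(1) by auto
  show ?thesis
  proof (intro conjI impI)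
    show "rapidly_decaying (S_minus \<alpha> f)" if "even_at_origin f"
      by (rule rapidly_decaying_even[OF assms(1) f r that])
    show "\<exists>c. has_asymptotic_expansion (S_minus \<alpha> f) n c"
      if "odd_at_origin f \<and> f \<in> O[at_right 0](\<lambda>x. of_real x ^ n)"
      using that by (intro asymptotic_expansion_vanishing[OF assms(1) f r]
          half_line_deriv_eq_0_of_bigo[OF f]) auto
  qed
qed

end
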